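(* Let $G_1$ be a connected graph on the vertex set $\{1,\ldots,d\}$ and assume that any two odd cycles in $G_1$ always have a common vertex. Let $G_2$ be a subgraph of $G_1$ (not necessarily connected). Then the Minkowski sum $\mathcal{P}_{G_1}+\mathcal{P}_{G_2}\subset\mathbb{R}^d$ of the edge polytopes has the integer decomposition property, and thus it is normal.
   Context: All graphs are finite and simple. An odd cycle is a cycle of odd length. For a graph $G$ with vertex set contained in $\{1,\ldots,d\}$ and edge set $E(G)$, and an edge $e=\{i,j\}\in E(G)$, put $\rho(e)=\mathbf{e}_i+\mathbf{e}_j\in\mathbb{R}^d$, where $\mathbf{e}_1,\ldots,\mathbf{e}_d$ are the standard coordinate vectors of $\mathbb{R}^d$. The edge polytope $\mathcal{P}_G\subset\mathbb{R}^d$ is the convex hull of $\{\rho(e):e\in E(G)\}$. The Minkowski sum of $A,B\subset\mathbb{R}^d$ is $A+B=\{a+b : a\in A, b\in B\}$, and $k\mathcal{P}=\{k\alpha:\alpha\in\mathcal{P}\}$. An integral convex polytope is a convex polytope whose vertices all have integer coordinates. An integral convex polytope $\mathcal{P}\subset\mathbb{R}^d$ has the integer decomposition property (IDP) if for every integer $k\ge 1$ and every $\alpha\in k\mathcal{P}\cap\mathbb{Z}^d$ there exist $\alpha_1,\ldots,\alpha_k\in\mathcal{P}\cap\mathbb{Z}^d$ with $\alpha=\alpha_1+\cdots+\alpha_k$. For an integral convex polytope $\mathcal{Q}$ let $L(\mathcal{Q})=\{v_0+\sum_{v\in\mathcal{Q}\cap\mathbb{Z}^d} z_v(v-v_0)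 : z_v\in\mathbb{Z}\}$, where $v_0$ is some vertex of $\mathcal{Q}$ (the affine lattice generated by $\mathcal{Q}\cap\mathbb{Z}^d$). $\mathcal{P}$ is normal if for every integer $k\ge 1$ and every $\alpha\in k\mathcal{P}\cap L(k\mathcal{P})$ there exist $\alpha_1,\ldots,\alpha_k\in\mathcal{P}\cap\mathbb{Z}^d$ with $\alpha=\alpha_1+\cdots+\alpha_k$. *)

theory Defs
  imports
    "HOL-Analysis.Analysis"
    "Graph_Theory.Pair_Digraph"
    "Graph_Theory.Digraph_Component"
begin

text \<open>
  A finite simple graph is a \<^locale>\<open>pair_graph\<close>: the undirected edge \<open>{i, j}\<close> is
  represented by the two arcs \<open>(i, j)\<close> and \<open>(j, i)\<close>.  The vertex set \<open>{1, \<dots>, d}\<close> is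
  the finite type \<open>'n\<close>, with \<open>d = CARD('n)\<close>.
\<close>

text \<open>
  In a symmetric digraph the library's directed cycles include the walks \<open>i, j, i\<close>, which
  are not cycles of the undirected graph.  They have length 2, so this does not affect odd
  cycles; in a loop-free graph odd cycles have length at least 3.
\<close>

definition odd_cycle :: "'a pair_pre_digraph \<Rightarrow> ('a \<times> 'a) awalk \<Rightarrow> bool" where
  "odd_cycle G p \<longleftrightarrow> pre_digraph.cycle (with_proj G) p \<and> odd (length p)"

definition cycle_verts :: "('a \<times> 'a) awalk \<Rightarrow> 'a set" where
  "cycle_verts p = fst ` set p \<union> snd ` set p"

definition edge_vector :: "'n \<times> 'n \<Rightarrow> real ^ 'n" where
  "edge_vector e = axis (fst e) 1 + axis (snd e) 1"

definition edge_polytope :: "'n::finite pair_pre_digraph \<Rightarrow> (real ^ 'n) set" where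
  "edge_polytope G = convex hull (edge_vector ` parcs G)"

definition integer_points :: "(real ^ 'n) set" where
  "integer_points = {x. \<forall>i. x $ i \<in> \<int>}"

definition integral_polytope :: "(real ^ 'n::finite) set \<Rightarrow> bool" where
  "integral_polytope P \<longleftrightarrow>
     polytope P \<and> (\<forall>v. v extreme_point_of P \<longrightarrow> v \<in> integer_points)"

definition dilate :: "nat \<Rightarrow> (real ^ 'n) set \<Rightarrow> (real ^ 'n) set" where
  "dilate k P = (\<lambda>x. real k *\<^sub>R x) ` P"

text \<open>
  For an integral polytope \<open>Q\<close> the base vertex \<open>v0\<close> belongs to \<open>Q \<inter> integer_points\<close>, so
  every choice of \<open>v0\<close> gives the same lattice and the union over all vertices taken here
  equals each of them.
\<close>

definition affine_lattice :: "(real ^ 'n::finite) set \<Rightarrow> (real ^ 'n) set" where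
  "affine_lattice Q =
     {v0 + (\<Sum>v \<in> Q \<inter> integer_points. of_int (z v) *\<^sub>R (v - v0)) | v0 (z :: real ^ 'n \<Rightarrow> int).
        v0 extreme_point_of Q}"

definition integer_decomposable :: "nat \<Rightarrow> (real ^ 'n) set \<Rightarrow> real ^ 'n \<Rightarrow> bool" where
  "integer_decomposable k P \<alpha> \<longleftrightarrow>
     (\<exists>a :: nat \<Rightarrow> real ^ 'n.
        (\<forall>i \<in> {1..k}. a i \<in> P \<inter> integer_points) \<and> \<alpha> = (\<Sum>i = 1..k. a i))"

definition has_IDP :: "(real ^ 'n::finite) set \<Rightarrow> bool" where
  "has_IDP P \<longleftrightarrow> integral_polytope P \<and>
     (\<forall>k \<ge> 1. \<forall>\<alpha> \<in> dilate k P \<inter> integer_points. integer_decomposable k P \<alpha>)"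

definition normal_polytope :: "(real ^ 'n::finite) set \<Rightarrow> bool" where
  "normal_polytope P \<longleftrightarrow> integral_polytope P \<and>
     (\<forall>k \<ge> 1. \<forall>\<alpha> \<in> dilate k P \<inter> affine_lattice (dilate k P). integer_decomposable k P \<alpha>)"

end

theory Submission
  imports Defs
begin

text \<open>
  A point \<open>\<alpha>\<close> of the \<open>k\<close>-th dilate is a nonnegative combination, of total weight \<open>2 * k\<close>, of
  edge vectors of \<open>G1\<close> in which the edges of \<open>G2\<close> carry weight at least \<open>k\<close>.  Conversely, an
  integral combination with this property decomposes \<open>\<alpha>\<close>: split off \<open>k\<close> edges of \<open>G2\<close>; the
  other \<open>k\<close> edges lie in \<open>G1\<close>.  So it suffices to round the weights to integers without
  changing \<open>\<alpha>\<close> or decreasing the weight on \<open>G2\<close>.  As long as the edge vectors with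
  fractional weight are linearly dependent, shifting along a dependency makes one more weight
  integral.  If they are independent, they would have to form vertex-disjoint odd cycles,
  hence a single odd cycle, which is impossible as the total weight is an integer.
\<close>

section \<open>Edge vectors and their coordinates\<close>

lemma edge_vector_nth: "edge_vector (i, j) $ k = (if k = i then 1 else 0) + (if k = j then 1 else 0)"
  by (auto simp: edge_vector_def axis_def)

lemma edge_vector_eq_iff:
  assumes "i \<noteq> j"
  shows "edge_vector (i, j) = edge_vector (k, l) \<longleftrightarrow> i = k \<and> j = l \<or> i = l \<and> j = k"
proof
  assume eq: "edge_vector (i, j) = edge_vector (k, l)"
  have "edge_vector (i, j) $ m = edge_vector (k, l) $ m" for m
    by (simp add: eq)
  from this[of i] this[of j] this[of k] this[of l] assms
  show "i = k \<and> j = l \<or> i = l \<and> j = k"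
    by (auto simp: edge_vector_nth split: if_splits)
qed (auto simp: edge_vector_def add.commute)

lemma edge_vector_swap: "edge_vector (i, j) = edge_vector (j, i)"
  by (simp add: edge_vector_def add.commute)

lemma sum_edge_vector: "(\<Sum>i\<in>UNIV. edge_vector e $ i) = 2"
  by (cases e) (simp add: edge_vector_nth sum.distrib)

section \<open>Cycles as sequences of vertices\<close>

text \<open>\<open>f 0, ..., f (n - 1)\<close> run through a cycle that \<open>f n = f 0\<close>
  closes. A bare arc set in place of a graph lets the notion apply to the edges of fractional weight
  alone; \<open>3 \<le> n\<close> excludes going back and forth along one edge.\<close>

definition cyclic_seq :: "('a \<times> 'a) set \<Rightarrow> (nat \<Rightarrow> 'a) \<Rightarrow> nat \<Rightarrow> bool" where
  "cyclic_seq A f n \<longleftrightarrow>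
     3 \<le> n \<and> inj_on f {..<n} \<and> f n = f 0 \<and> (\<forall>i<n. (f i, f (Suc i)) \<in> A)"

lemma cyclic_seq_mono: "cyclic_seq A f n \<Longrightarrow> A \<subseteq> B \<Longrightarrow> cyclic_seq B f n"
  unfolding cyclic_seq_def by blast

text \<open>A walk that never turns straight back can always be continued. By finiteness it repeats
  a vertex, and at the first repetition the part between the two visits is a cycle.\<close>

lemma cyclic_seq_exists:
  assumes fin: "finite A" and ne: "A \<noteq> {}"
    and irr: "\<And>i. (i, i) \<notin> A"
    and ext: "\<And>i j. (i, j) \<in> A \<Longrightarrow> \<exists>k. (j, k) \<in> A \<and> k \<noteq> i"
  obtains f n where "cyclic_seq A f n"
proof -
  obtain a where a: "a \<in> A"
    using ne by auto
  \<comment> \<open>The walk is built as a sequence of arcs, because not turning back is a condition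
    on consecutive arcs.\<close>
  have "\<exists>g. \<forall>n. g n \<in> A \<and> fst (g (Suc n)) = snd (g n) \<and> snd (g (Suc n)) \<noteq> fst (g n)"
  proof (rule dependent_nat_choice)
    show "\<exists>x. x \<in> A"
      using a by blast
    show "\<exists>y. y \<in> A \<and> fst y = snd x \<and> snd y \<noteq> fst x" if "x \<in> A" for x and n :: nat
      using ext[of "fst x" "snd x"] that by auto
  qed
  then obtain g where g: "\<And>n. g n \<in> A" "\<And>n. fst (g (Suc n)) = snd (g n)"
      "\<And>n. snd (g (Suc n)) \<noteq> fst (g n)"
    by blast
  define h where "h n = fst (g n)" for n
  have hA: "(h n, h (Suc n)) \<in> A" for n
    using g(1)[of n] g(2)[of n] by (simp add: h_def)
  have h2: "h (Suc (Suc n)) \<noteq> h n" for n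
    using g(2)[of "Suc n"] g(3)[of n] by (simp add: h_def)
  have "range h \<subseteq> fst ` A"
    using g(1) by (auto simp: h_def)
  then have "finite (range h)"
    using fin finite_surj by blast
  then have "\<not> inj h"
    using finite_imageD infinite_UNIV_nat by blast
  then have ex: "\<exists>j. \<exists>i<j. h i = h j"
    unfolding inj_def by (metis linorder_neqE_nat)
  \<comment> \<open>\<open>j\<close> is the first time at which a vertex recurs and \<open>i\<close>
    its earlier visit, so the vertices before time \<open>j\<close> are pairwise distinct.\<close>
  define j where "j = (LEAST j. \<exists>i<j. h i = h j)"
  from LeastI_ex[OF ex] obtain i where ij: "i < j" "h i = h j"
    unfolding j_def by blast
  have minj: "h p \<noteq> h q" if "p < q" "q < j" for p q
    using not_less_Least[of q "\<lambda>j. \<exists>i<j. h i = h j"] that unfolding j_def by blast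
  define f where "f m = h (i + m)" for m
  \<comment> \<open>A return after one step would be a loop, a return after two steps a turn
    straight back.\<close>
  have "j \<noteq> Suc i"
    using hA[of i] ij irr by metis
  moreover have "j \<noteq> Suc (Suc i)"
    using h2[of i] ij by metis
  ultimately have "3 \<le> j - i"
    using ij by linarith
  moreover have "inj_on f {..<j - i}"
  proof (rule linorder_inj_onI)
    fix p q assume "p < q" "p \<in> {..<j - i}" "q \<in> {..<j - i}"
    then show "f p \<noteq> f q"
      using minj[of "i + p" "i + q"] by (auto simp: f_def)
  qed auto
  moreover have "f (j - i) = f 0"
    using ij by (simp add: f_def)
  ultimately have "cyclic_seq A f (j - i)"
    using hA by (auto simp: cyclic_seq_def f_def)
  then show ?thesis
    by (rule that)
qed

lemma cyclic_seq_irrefl: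
  assumes "cyclic_seq A f n" "i < n"
  shows "f i \<noteq> f (Suc i)"
proof
  assume eq: "f i = f (Suc i)"
  from assms have inj: "inj_on f {..<n}" and n: "3 \<le> n" "f n = f 0"
    by (auto simp: cyclic_seq_def)
  show False
  proof (cases "Suc i = n")
    case True
    then have "f i = f 0" using eq n by simp
    then have "i = 0" using inj_onD[OF inj, of i 0] assms(2) n by auto
    then show False using True n by simp
  next
    case False
    then show False using inj_onD[OF inj eq] assms(2) by auto
  qed
qed

text \<open>An edge vector forgets the direction of its arc, so it must also be excluded that an
  edge is traversed both ways; this is where \<open>3 \<le> n\<close> enters.\<close>

lemma cyclic_seq_edge_vectors_inj:
  assumes cyc: "cyclic_seq A f n"
  shows "inj_on (\<lambda>i. edge_vector (f i, f (Suc i))) {..<n}"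
proof (rule inj_onI)
  fix i j assume ij: "i \<in> {..<n}" "j \<in> {..<n}"
    and "edge_vector (f i, f (Suc i)) = edge_vector (f j, f (Suc j))"
  then have eq: "f i = f j \<or> f i = f (Suc j) \<and> f (Suc i) = f j"
    using edge_vector_eq_iff[OF cyclic_seq_irrefl[OF cyc, of i]] by auto
  from cyc have inj: "inj_on f {..<n}" and n: "3 \<le> n" "f n = f 0"
    by (auto simp: cyclic_seq_def)
  have inj': "f p = f q \<Longrightarrow> p < n \<Longrightarrow> q < n \<Longrightarrow> p = q" for p q
    using inj_onD[OF inj] by auto
  have succ: "Suc q = p \<or> Suc q = n \<and> p = 0" if "f p = f (Suc q)" "p < n" "q < n" for p q
    using inj'[of p "Suc q"] inj'[of p 0] that n by (cases "Suc q = n") auto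
  from eq show "i = j"
  proof
    assume "f i = f j"
    then show ?thesis using inj' ij by auto
  next
    \<comment> \<open>Here \<open>i\<close> and \<open>j\<close> would be cyclic successors of each
      other, so \<open>n\<close> would divide 2.\<close>
    assume "f i = f (Suc j) \<and> f (Suc i) = f j"
    then show ?thesis using succ[of i j] succ[of j i] ij n(1) by auto
  qed
qed

lemma alternating_sum_telescope:
  fixes x :: "nat \<Rightarrow> 'a :: real_vector"
  shows "(\<Sum>i<n. (- 1) ^ i *\<^sub>R (x i + x (Suc i))) = x 0 - (- 1) ^ n *\<^sub>R x n"
  by (induction n) (auto simp: algebra_simps)

text \<open>The dependency is the alternating sum around the cycle, which telescopes to zero.\<close>

lemma even_cyclic_seq_dependent:
  fixes f :: "nat \<Rightarrow> 'n::finite"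
  assumes cyc: "cyclic_seq A f n" and "even n"
  shows "dependent ((\<lambda>i. edge_vector (f i, f (Suc i))) ` {..<n})"
proof -
  let ?e = "\<lambda>i. edge_vector (f i, f (Suc i))"
  let ?u = "\<lambda>v. (- 1 :: real) ^ (the_inv_into {..<n} ?e v)"
  have n: "3 \<le> n" "f n = f 0"
    using cyc by (auto simp: cyclic_seq_def)
  note inj = cyclic_seq_edge_vectors_inj[OF cyc]
  have "(\<Sum>v\<in>?e ` {..<n}. ?u v *\<^sub>R v) = (\<Sum>i<n. (- 1) ^ i *\<^sub>R ?e i)"
    by (simp add: sum.reindex[OF inj] the_inv_into_f_f[OF inj])
  also have "\<dots> = 0"
    using alternating_sum_telescope[of "\<lambda>i. axis (f i) 1" n] \<open>even n\<close> n
    by (simp add: edge_vector_def)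
  finally have "(\<Sum>v\<in>?e ` {..<n}. ?u v *\<^sub>R v) = 0" .
  moreover have "?e 0 \<in> ?e ` {..<n}"
    using n by (intro imageI) auto
  moreover have "?u (?e 0) \<noteq> 0"
    by simp
  ultimately have "\<exists>v\<in>?e ` {..<n}. ?u v \<noteq> 0" "(\<Sum>v\<in>?e ` {..<n}. ?u v *\<^sub>R v) = 0"
    by blast+
  then show ?thesis
    unfolding dependent_explicit by (intro exI[of _ "?e ` {..<n}"] exI[of _ ?u]) auto
qed

text \<open>As \<open>n\<close> is odd, the terms after the first split into adjacent pairs, each
  with an integral sum.\<close>

lemma Ints_first_of_odd_sum:
  fixes x :: "nat \<Rightarrow> real"
  assumes "(\<Sum>i<n. x i) \<in> \<int>" "odd n"
    and "\<And>i. Suc i < n \<Longrightarrow> x i + x (Suc i) \<in> \<int>"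
  shows "x 0 \<in> \<int>"
proof -
  obtain m where m: "n = Suc (2 * m)"
    using \<open>odd n\<close> by (auto elim: oddE)
  have "(\<Sum>i<Suc (2 * m). x i) = x 0 + (\<Sum>i<m. x (Suc (2 * i)) + x (Suc (Suc (2 * i))))"
    by (induction m) auto
  then have "x 0 = (\<Sum>i<n. x i) - (\<Sum>i<m. x (Suc (2 * i)) + x (Suc (Suc (2 * i))))"
    by (simp add: m)
  moreover have "(\<Sum>i<m. x (Suc (2 * i)) + x (Suc (Suc (2 * i)))) \<in> \<int>"
    by (rule Ints_sum) (auto simp: m intro!: assms(3))
  ultimately show ?thesis
    using assms(1) by (simp add: Ints_diff)
qed

text \<open>Makes the hypothesis on odd cycles of the graph available for cyclic sequences, by
  reading the consecutive arcs as a closed walk.\<close>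

lemma odd_cycle_of_cyclic_seq:
  assumes G: "pair_graph G" and cyc: "cyclic_seq (parcs G) f n" and "odd n"
  shows "\<exists>p. odd_cycle G p \<and> cycle_verts p = f ` {..<n}"
proof -
  interpret pair_graph G by fact
  let ?p = "map (\<lambda>i. (f i, f (Suc i))) [0..<n]"
  have n: "3 \<le> n" "f n = f 0" and inj: "inj_on f {..<n}"
    and arc: "\<And>i. i < n \<Longrightarrow> (f i, f (Suc i)) \<in> parcs G"
    using cyc by (auto simp: cyclic_seq_def)
  \<comment> \<open>The arbitrary start \<open>k\<close> allows the induction to strip off the first
    arc.\<close>
  have cas: "pre_digraph.cas (with_proj G) (f k) (map (\<lambda>i. (f i, f (Suc i))) [k..<k + m]) (f (k + m))" for k m
  proof (induction m arbitrary: k)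
    case 0
    then show ?case by simp
  next
    case (Suc m)
    have "[k..<k + Suc m] = k # [Suc k..<Suc k + m]"
      by (simp add: upt_conv_Cons)
    then show ?case using Suc[of "Suc k"] by simp
  qed
  have aw: "pre_digraph.awalk (with_proj G) (f 0) ?p (f 0)"
    using cas[of 0 n] arc n in_arcsD1[OF arc[of 0]]
    by (auto simp: pre_digraph.awalk_def)
  \<comment> \<open>A library cycle requires the vertices after the first,
    \<open>f 1, ..., f n\<close>, to be distinct. They are the \<open>n\<close> vertices
    \<open>f 0, ..., f (n - 1)\<close> again, so distinctness follows by counting.\<close>
  have surj: "f ` {1..n} = f ` {..<n}"
  proof -
    have "{1..n} = insert n {1..<n}" "{..<n} = insert 0 {1..<n}"
      using n by auto
    then show ?thesis using n by (metis image_insert)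
  qed
  have "tl (pre_digraph.awalk_verts (with_proj G) (f 0) ?p) = map (\<lambda>i. f (Suc i)) [0..<n]"
    using pre_digraph.awalk_verts_conv'[of "with_proj G" "f 0" ?p "f 0"] aw n
    by (simp add: pre_digraph.awalk_def o_def)
  also have "\<dots> = map f [1..<Suc n]"
    by (simp add: map_Suc_upt[symmetric] del: upt_Suc)
  also have "distinct \<dots>"
  proof -
    have "card (f ` {1..n}) = n"
      using surj inj by (simp add: card_image)
    then have "inj_on f {1..n}"
      by (intro eq_card_imp_inj_on) auto
    then show ?thesis
      by (simp add: distinct_map atLeastLessThanSuc_atLeastAtMost del: upt_Suc)
  qed
  finally have "odd_cycle G ?p"
    using aw n \<open>odd n\<close> by (auto simp: odd_cycle_def pre_digraph.cycle_def)
  moreover have "cycle_verts ?p = f ` {..<n}"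
  proof -
    have "(\<lambda>i. f (Suc i)) ` {..<n} = f ` {1..n}"
      by (metis One_nat_def image_Suc_lessThan image_image)
    then show ?thesis
      using surj by (simp add: cycle_verts_def image_image atLeast0LessThan)
  qed
  ultimately show ?thesis by blast
qed

section \<open>Independent edges of fractional weight\<close>

text \<open>
  Every vertex meeting \<open>F\<close> meets it at least twice, since the weights around it sum to an
  integer; independence bounds the number of edges by the number of vertices met.  So \<open>F\<close> is
  2-regular, a disjoint union of cycles, all odd and hence only one.  Around this cycle
  consecutive weights have integer sums, and so does the whole cycle: a contradiction.
\<close>

lemma independent_fractional_edges_empty:
  fixes F :: "(real ^ 'n::finite) set" and c :: "real ^ 'n \<Rightarrow> real"
  defines "A \<equiv> {(i, j). i \<noteq> j \<and> edge_vector (i, j) \<in> F}"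
  assumes F: "\<And>v. v \<in> F \<Longrightarrow> \<exists>i j. i \<noteq> j \<and> v = edge_vector (i, j)"
    and indep: "independent F"
    and frac: "\<And>v. v \<in> F \<Longrightarrow> c v \<notin> \<int>"
    and ints: "\<And>i. (\<Sum>v\<in>F. c v * v $ i) \<in> \<int>"
    and total: "(\<Sum>v\<in>F. c v) \<in> \<int>"
    and odd_meet: "\<And>f n g m. cyclic_seq A f n \<Longrightarrow> odd n \<Longrightarrow> cyclic_seq A g m \<Longrightarrow> odd m \<Longrightarrow>
                     f ` {..<n} \<inter> g ` {..<m} \<noteq> {}"
  shows "F = {}"
proof (rule ccontr)
  assume "F \<noteq> {}"
  have finF: "finite F"
    using indep independent_imp_finite by blast
  \<comment> \<open>\<open>D i\<close> is the set of edges of \<open>F\<close> at the vertex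
    \<open>i\<close>, and \<open>W\<close> the set of vertices met by \<open>F\<close>.\<close>
  define D where "D i = {v \<in> F. v $ i \<noteq> 0}" for i
  define W where "W = {i. D i \<noteq> {}}"
  have finD: "finite (D i)" for i
    using finF by (simp add: D_def)
  \<comment> \<open>The ends of an edge are distinct, so no coordinate equals 2.\<close>
  have nth: "v $ i = (if v \<in> D i then 1 else 0)" if "v \<in> F" for v i
    using F[OF that] that by (auto simp: D_def edge_vector_nth split: if_splits)
  have sym: "(j, i) \<in> A" if "(i, j) \<in> A" for i j
    using that by (auto simp: A_def edge_vector_swap)
  have in_D: "edge_vector (i, j) \<in> D i" "edge_vector (i, j) \<in> D j" if "(i, j) \<in> A" for i j
    using that by (auto simp: A_def D_def edge_vector_nth)
  have D_E: "\<exists>j. (i, j) \<in> A \<and> v = edge_vector (i, j)" if "v \<in> D i" for i v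
  proof -
    have "v \<in> F" using that by (simp add: D_def)
    then obtain k l where kl: "k \<noteq> l" "v = edge_vector (k, l)"
      using F by blast
    then have "i = k \<or> i = l"
      using that by (auto simp: D_def edge_vector_nth split: if_splits)
    then show ?thesis
      using kl \<open>v \<in> F\<close> by (auto simp: A_def edge_vector_swap)
  qed
  have intsD: "(\<Sum>v\<in>D i. c v) \<in> \<int>" for i
  proof -
    have "(\<Sum>v\<in>F. c v * v $ i) = (\<Sum>v\<in>F. if v \<in> D i then c v else 0)"
      by (intro sum.cong) (auto simp: nth)
    also have "\<dots> = (\<Sum>v\<in>D i. c v)"
      using finF by (simp add: sum.If_cases D_def Int_def)
    finally show ?thesis using ints[of i] by simp
  qed
  have in_W: "i \<in> W" "j \<in> W" if "(i, j) \<in> A" for i j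
    using in_D[OF that] unfolding W_def by auto
  have cardD: "2 \<le> card (D i)" if "i \<in> W" for i
  proof (rule ccontr)
    assume "\<not> 2 \<le> card (D i)"
    moreover have "card (D i) \<noteq> 0"
      using that finD by (simp add: W_def)
    ultimately have "card (D i) = 1" by linarith
    then obtain v where v: "D i = {v}"
      by (auto simp: card_1_singleton_iff)
    then have "v \<in> F" by (auto simp: D_def)
    then show False using intsD[of i] frac v by auto
  qed
  have "card F \<le> card W"
  proof -
    have "F \<subseteq> span ((\<lambda>i. axis i 1) ` W)"
    proof
      fix v assume "v \<in> F"
      then obtain i j where ij: "i \<noteq> j" "v = edge_vector (i, j)"
        using F by blast
      then have "(i, j) \<in> A" using \<open>v \<in> F\<close> by (simp add: A_def)
      then have "i \<in> W" "j \<in> W" by (rule in_W)+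
      then show "v \<in> span ((\<lambda>i. axis i 1) ` W)"
        unfolding ij(2) edge_vector_def fst_conv snd_conv by (intro span_add span_base imageI)
    qed
    then have "card F \<le> card ((\<lambda>i. axis i 1 :: real ^ 'n) ` W)"
      using independent_span_bound[OF _ indep] by auto
    also have "\<dots> \<le> card W"
      by (rule card_image_le) simp
    finally show ?thesis .
  qed
  \<comment> \<open>Handshake count: every edge vector has coordinate sum 2. With
    \<open>card F \<le> card W\<close> the average degree on \<open>W\<close> is at most 2, while by
    \<open>cardD\<close> each degree is at least 2.\<close>
  moreover have dc: "(\<Sum>i\<in>W. card (D i)) = 2 * card F"
  proof -
    have "real (\<Sum>i\<in>W. card (D i)) = (\<Sum>i\<in>UNIV. real (card (D i)))"
      unfolding of_nat_sum by (rule sum.mono_neutral_left) (auto simp: W_def)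
    also have "\<dots> = (\<Sum>i\<in>UNIV. \<Sum>v\<in>F. v $ i)"
    proof (intro sum.cong refl)
      fix i
      have "(\<Sum>v\<in>F. v $ i) = (\<Sum>v\<in>F. if v \<in> D i then 1 else 0)"
        by (intro sum.cong) (auto simp: nth)
      also have "\<dots> = real (card (D i))"
        using finF by (simp add: sum.If_cases D_def Int_def)
      finally show "real (card (D i)) = (\<Sum>v\<in>F. v $ i)" by simp
    qed
    also have "\<dots> = (\<Sum>v\<in>F. \<Sum>i\<in>UNIV. v $ i)"
      by (rule sum.swap)
    also have "\<dots> = (\<Sum>v\<in>F. 2)"
      using F by (intro sum.cong refl) (metis sum_edge_vector)
    finally have "real (\<Sum>i\<in>W. card (D i)) = real (2 * card F)"
      by simp
    then show ?thesis by linarith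
  qed
  ultimately have le: "(\<Sum>i\<in>W. card (D i)) \<le> (\<Sum>i\<in>W. 2)"
    by simp
  have D2: "card (D i) = 2" if "i \<in> W" for i
  proof (rule ccontr)
    assume "card (D i) \<noteq> 2"
    then have "2 < card (D i)" using cardD[OF that] by simp
    then have "(\<Sum>i\<in>W. 2) < (\<Sum>i\<in>W. card (D i))"
      using cardD that by (intro sum_strict_mono_ex1) auto
    then show False using le by simp
  qed
  \<comment> \<open>Since the degree is 2, two distinct edges at \<open>i\<close> are all the edges
    there.\<close>
  have D_pair: "D i = {edge_vector (i, j), edge_vector (i, k)}"
    if "(i, j) \<in> A" "(i, k) \<in> A" "j \<noteq> k" for i j k
  proof -
    have "edge_vector (i, j) \<noteq> edge_vector (i, k)"
      using that edge_vector_eq_iff[of i j i k] by (auto simp: A_def)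
    then have "card {edge_vector (i, j), edge_vector (i, k)} = 2"
      by simp
    moreover have "i \<in> W" using that(1) by (rule in_W)
    ultimately show ?thesis
      using card_subset_eq[OF finD[of i], of "{edge_vector (i, j), edge_vector (i, k)}"]
        in_D(1)[OF that(1)] in_D(1)[OF that(2)] D2[of i] by auto
  qed
  have irr: "(i, i) \<notin> A" for i by (simp add: A_def)
  \<comment> \<open>The second edge at \<open>j\<close> continues the walk.\<close>
  have ext: "\<exists>k. (j, k) \<in> A \<and> k \<noteq> i" if "(i, j) \<in> A" for i j
  proof -
    have "j \<in> W" using that by (rule in_W)
    then have "card (D j) = 2" by (rule D2)
    then obtain v where v: "v \<in> D j" "v \<noteq> edge_vector (j, i)"
      by (metis card_2_iff' )
    then show ?thesis using D_E[OF v(1)] by auto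
  qed
  have odd_seq: "odd n" if "cyclic_seq A f n" for f n
  proof
    assume "even n"
    have "(\<lambda>i. edge_vector (f i, f (Suc i))) ` {..<n} \<subseteq> F"
      using that by (auto simp: cyclic_seq_def A_def)
    then show False
      using even_cyclic_seq_dependent[OF that \<open>even n\<close>] indep dependent_mono by blast
  qed
  have "A \<noteq> {}"
    using \<open>F \<noteq> {}\<close> F by (fastforce simp: A_def)
  then obtain f n where cyc: "cyclic_seq A f n"
    using cyclic_seq_exists[of A] irr ext by (metis finite)
  let ?V = "f ` {..<n}"
  let ?e = "\<lambda>i. edge_vector (f i, f (Suc i))"
  have n: "3 \<le> n" "f n = f 0" and inj: "inj_on f {..<n}"
    and arc: "\<And>i. i < n \<Longrightarrow> (f i, f (Suc i)) \<in> A"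
    using cyc by (auto simp: cyclic_seq_def)
  have D_Suc: "D (f (Suc i)) = {?e i, ?e (Suc i)}" if "Suc i < n" for i
  proof -
    have "f i \<noteq> f (Suc (Suc i))"
    proof
      assume eq: "f i = f (Suc (Suc i))"
      show False
      proof (cases "Suc (Suc i) = n")
        case True
        then show False using inj_onD[OF inj, of i 0] eq n by auto
      next
        case False
        then show False using inj_onD[OF inj eq] that by auto
      qed
    qed
    then show ?thesis
      using D_pair[of "f (Suc i)" "f i" "f (Suc (Suc i))"] sym[OF arc[of i]] arc[of "Suc i"] that
      by (simp add: edge_vector_swap[of "f (Suc i)" "f i"])
  qed
  \<comment> \<open>At \<open>f 0\<close> the indices wrap around: the edge before
    \<open>?e 0\<close> is \<open>?e (n - 1)\<close>.\<close>
  have D_0: "D (f 0) = {?e (n - 1), ?e 0}"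
  proof -
    have last: "Suc (n - 1) = n" using n by simp
    have "f (n - 1) \<noteq> f 1"
      using inj_onD[OF inj, of "n - 1" 1] n by auto
    then show ?thesis
      using D_pair[of "f 0" "f (n - 1)" "f 1"] sym[OF arc[of "n - 1"]] arc[of 0] n last
      by (simp add: edge_vector_swap[of "f 0" "f (n - Suc 0)"])
  qed
  have D_V: "D i \<subseteq> ?e ` {..<n}" if "i \<in> ?V" for i
  proof -
    obtain m where m: "i = f m" "m < n" using \<open>i \<in> ?V\<close> by auto
    show ?thesis
    proof (cases m)
      case 0
      have "?e (n - 1) \<in> ?e ` {..<n}" "?e 0 \<in> ?e ` {..<n}"
        by (rule imageI, use n in simp)+
      then show ?thesis
        unfolding m(1) 0 D_0 by (intro insert_subsetI empty_subsetI)
    next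
      case (Suc k)
      have "?e k \<in> ?e ` {..<n}" "?e (Suc k) \<in> ?e ` {..<n}"
        by (rule imageI, use m Suc in simp)+
      moreover have "D (f m) = {?e k, ?e (Suc k)}"
        using D_Suc[of k] m(2) Suc by (simp only:)
      ultimately show ?thesis
        unfolding m(1) by (simp only: insert_subset empty_subsetI simp_thms)
    qed
  qed
  \<comment> \<open>The cycle already uses both edges at each of its vertices, so no edge leaves
    it.\<close>
  have V_closed: "j \<in> ?V" if ij: "(i, j) \<in> A" and "i \<in> ?V" for i j
  proof -
    obtain k where k: "k < n" "edge_vector (i, j) = ?e k"
      using in_D(1)[OF ij] D_V[OF \<open>i \<in> ?V\<close>] by auto
    then have "j = f k \<or> j = f (Suc k)"
      using edge_vector_eq_iff[of i j] ij by (auto simp: A_def)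
    moreover have "f (Suc k) \<in> ?V"
      using k n by (cases "Suc k = n") auto
    ultimately show ?thesis using k by auto
  qed
  \<comment> \<open>The arcs off the cycle again have no dead ends. If there were any, they would
    contain a second odd cycle, disjoint from the first.\<close>
  let ?A' = "{(i, j) \<in> A. i \<notin> ?V}"
  have "?A' = {}"
  proof (rule ccontr)
    assume "?A' \<noteq> {}"
    moreover have "\<exists>k. (j, k) \<in> ?A' \<and> k \<noteq> i" if "(i, j) \<in> ?A'" for i j
      using that ext[of i j] V_closed[OF sym[of i j]] by auto
    moreover have "(i, i) \<notin> ?A'" for i using irr by auto
    ultimately obtain g m where g: "cyclic_seq ?A' g m"
      using cyclic_seq_exists[of ?A'] by (metis (no_types, lifting) finite)
    then have g': "cyclic_seq A g m" by (auto simp: cyclic_seq_def)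
    have "g ` {..<m} \<inter> ?V = {}"
      using g by (auto simp: cyclic_seq_def)
    then show False
      using odd_meet[OF g' odd_seq[OF g'] cyc odd_seq[OF cyc]] by simp
  qed
  then have F_eq: "F = ?e ` {..<n}"
  proof (intro equalityI subsetI)
    fix v assume "v \<in> F"
    then obtain i j where ij: "i \<noteq> j" "v = edge_vector (i, j)"
      using F by blast
    then have "(i, j) \<in> A" using \<open>v \<in> F\<close> by (simp add: A_def)
    moreover from this have "i \<in> ?V" using \<open>?A' = {}\<close> by auto
    ultimately show "v \<in> ?e ` {..<n}"
      using in_D(1) D_V ij(2) by blast
  next
    fix v assume "v \<in> ?e ` {..<n}"
    then show "v \<in> F" using arc by (auto simp: A_def)
  qed
  note inj_e = cyclic_seq_edge_vectors_inj[OF cyc]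
  have "(\<Sum>i<n. c (?e i)) \<in> \<int>"
    using total unfolding F_eq sum.reindex[OF inj_e] by simp
  moreover have "c (?e i) + c (?e (Suc i)) \<in> \<int>" if "Suc i < n" for i
  proof -
    have "?e i \<noteq> ?e (Suc i)"
      using inj_onD[OF inj_e, of i "Suc i"] that by auto
    then show ?thesis
      using intsD[of "f (Suc i)"] unfolding D_Suc[OF that] by simp
  qed
  ultimately have "c (?e 0) \<in> \<int>"
    using Ints_first_of_odd_sum[of "\<lambda>i. c (?e i)" n] odd_seq[OF cyc] by simp
  then show False
    using frac[of "?e 0"] arc[of 0] n by (simp add: A_def)
qed

section \<open>Rounding the weights\<close>

text \<open>
  The direction \<open>g\<close> is a dependency among the fractional edges, signed so that the objective
  \<open>w\<close> does not decrease; \<open>t\<close> is the first time at which a weight reaches the integer next to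
  it.
\<close>

lemma shift_along_dependency:
  fixes S :: "(real ^ 'n::finite) set" and c w :: "real ^ 'n \<Rightarrow> real"
  defines "F \<equiv> {v \<in> S. c v \<notin> \<int>}"
  assumes fin: "finite S" and nonneg: "\<And>v. v \<in> S \<Longrightarrow> 0 \<le> c v" and dep: "dependent F"
  obtains c' where "\<And>v. v \<in> S \<Longrightarrow> 0 \<le> c' v" "(\<Sum>v\<in>S. c' v *\<^sub>R v) = (\<Sum>v\<in>S. c v *\<^sub>R v)"
    "(\<Sum>v\<in>S. w v * c v) \<le> (\<Sum>v\<in>S. w v * c' v)"
    "card {v \<in> S. c' v \<notin> \<int>} < card {v \<in> S. c v \<notin> \<int>}"
proof -
  have finF: "finite F" using fin by (simp add: F_def)
  obtain u where u: "\<exists>v\<in>F. u v \<noteq> 0" "(\<Sum>v\<in>F. u v *\<^sub>R v) = 0"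
    using dep dependent_finite[OF finF] by blast
  define s :: real where "s = (if 0 \<le> (\<Sum>v\<in>F. w v * u v) then 1 else - 1)"
  define g where "g v = (if v \<in> F then s * u v else 0)" for v
  have sum_F: "(\<Sum>v\<in>S. h v) = (\<Sum>v\<in>F. h v)" if "\<And>v. v \<notin> F \<Longrightarrow> h v = 0"
    for h :: "real ^ 'n \<Rightarrow> 'b::comm_monoid_add"
    using that by (intro sum.mono_neutral_right fin) (auto simp: F_def)
  have g0: "(\<Sum>v\<in>S. g v *\<^sub>R v) = 0"
  proof -
    have "(\<Sum>v\<in>S. g v *\<^sub>R v) = (\<Sum>v\<in>F. s *\<^sub>R (u v *\<^sub>R v))"
      by (subst sum_F) (auto simp: g_def intro!: sum.cong)
    also have "\<dots> = s *\<^sub>R (\<Sum>v\<in>F. u v *\<^sub>R v)"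
      by (rule scaleR_sum_right[symmetric])
    finally show ?thesis using u by simp
  qed
  have gw: "0 \<le> (\<Sum>v\<in>S. w v * g v)"
  proof -
    have "(\<Sum>v\<in>S. w v * g v) = (\<Sum>v\<in>F. s * (w v * u v))"
      by (subst sum_F) (auto simp: g_def intro!: sum.cong)
    also have "\<dots> = s * (\<Sum>v\<in>F. w v * u v)"
      by (rule sum_distrib_left[symmetric])
    finally show ?thesis by (simp add: s_def)
  qed
  define R where "R = {v \<in> F. g v \<noteq> 0}"
  have R: "finite R" "R \<noteq> {}"
    using finF u by (auto simp: R_def g_def s_def)
  define b where "b v = real_of_int (if 0 < g v then \<lceil>c v\<rceil> else \<lfloor>c v\<rfloor>)" for v
  define \<tau> where "\<tau> v = (b v - c v) / g v" for v
  define t where "t = Min (\<tau> ` R)"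
  have "t \<in> \<tau> ` R"
    unfolding t_def using R by (intro Min_in) auto
  then obtain r where r: "r \<in> R" "t = \<tau> r" by blast
  have t_le: "t \<le> \<tau> v" if "v \<in> R" for v
    using that R by (simp add: t_def)
  have "0 \<le> \<tau> v" for v
    unfolding \<tau>_def b_def by (auto intro!: divide_nonneg_nonneg divide_nonpos_nonpos)
  then have "0 \<le> t" using r by simp
  define c' where "c' v = c v + t * g v" for v
  show ?thesis
  proof
    \<comment> \<open>Only a decreasing weight is at risk; it stops no lower than its floor, which
      is nonnegative.\<close>
    show "0 \<le> c' v" if "v \<in> S" for v
    proof (cases "g v < 0")
      case True
      then have "v \<in> R" by (auto simp: R_def g_def split: if_splits)
      then have "t * g v \<ge> \<tau> v * g v"
        using True t_le by (intro mult_right_mono_neg) auto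
      moreover have "\<tau> v * g v = \<lfloor>c v\<rfloor> - c v"
        using True by (simp add: \<tau>_def b_def)
      ultimately have "c' v \<ge> \<lfloor>c v\<rfloor>" by (simp add: c'_def)
      moreover have "0 \<le> \<lfloor>c v\<rfloor>" using nonneg[OF that] by simp
      ultimately show ?thesis by linarith
    next
      case False
      then show ?thesis using nonneg[OF that] \<open>0 \<le> t\<close> by (simp add: c'_def)
    qed
    have "(\<Sum>v\<in>S. c' v *\<^sub>R v) = (\<Sum>v\<in>S. c v *\<^sub>R v) + t *\<^sub>R (\<Sum>v\<in>S. g v *\<^sub>R v)"
      by (simp add: c'_def scaleR_add_left sum.distrib scaleR_sum_right)
    then show "(\<Sum>v\<in>S. c' v *\<^sub>R v) = (\<Sum>v\<in>S. c v *\<^sub>R v)"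
      using g0 by simp
    have "(\<Sum>v\<in>S. w v * c' v) = (\<Sum>v\<in>S. w v * c v) + t * (\<Sum>v\<in>S. w v * g v)"
      by (simp add: c'_def algebra_simps sum.distrib sum_distrib_left)
    then show "(\<Sum>v\<in>S. w v * c v) \<le> (\<Sum>v\<in>S. w v * c' v)"
      using gw \<open>0 \<le> t\<close> by simp
    \<comment> \<open>The weight of \<open>r\<close> becomes an integer, and \<open>g\<close>
      vanishes off \<open>F\<close>, so no integral weight turns fractional.\<close>
    have "c' r = b r"
      using r by (simp add: c'_def \<tau>_def R_def)
    then have "c' r \<in> \<int>" by (simp add: b_def)
    moreover have "r \<in> F" using r by (simp add: R_def)
    moreover have "{v \<in> S. c' v \<notin> \<int>} \<subseteq> F"
      by (auto simp: c'_def g_def F_def split: if_splits)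
    ultimately have "{v \<in> S. c' v \<notin> \<int>} \<subset> F" by auto
    then show "card {v \<in> S. c' v \<notin> \<int>} < card {v \<in> S. c v \<notin> \<int>}"
      using psubset_card_mono[OF finF] by (simp add: F_def)
  qed
qed

text \<open>Every edge vector has coordinate sum 2. Hence the total weight depends only on the
  vector represented and survives every shift.\<close>

lemma sum_coords_weighted_edges:
  fixes S :: "(real ^ 'n::finite) set" and c :: "real ^ 'n \<Rightarrow> real"
  assumes "\<And>v. v \<in> S \<Longrightarrow> \<exists>i j. i \<noteq> j \<and> v = edge_vector (i, j)"
  shows "(\<Sum>i\<in>UNIV. (\<Sum>v\<in>S. c v *\<^sub>R v) $ i) = 2 * (\<Sum>v\<in>S. c v)"
proof -
  have "(\<Sum>i\<in>UNIV. (\<Sum>v\<in>S. c v *\<^sub>R v) $ i) = (\<Sum>v\<in>S. \<Sum>i\<in>UNIV. c v * v $ i)"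
    by (simp add: sum.swap[of _ S])
  also have "\<dots> = (\<Sum>v\<in>S. c v * 2)"
    using assms by (intro sum.cong refl) (metis sum_distrib_left sum_edge_vector)
  also have "\<dots> = 2 * (\<Sum>v\<in>S. c v)"
    unfolding sum_distrib_right[symmetric] by simp
  finally show ?thesis .
qed

text \<open>Induction on the number of fractional weights: a dependency among their edges yields a
  shift that lowers it, and independence forces it to be zero. The objective \<open>w\<close> will
  be the indicator of the edges of \<open>G2\<close>.\<close>

lemma integral_edge_weights:
  fixes S :: "(real ^ 'n::finite) set" and c w :: "real ^ 'n \<Rightarrow> real"
  defines "A \<equiv> {(i, j). i \<noteq> j \<and> edge_vector (i, j) \<in> S}"
  assumes fin: "finite S"
    and S: "\<And>v. v \<in> S \<Longrightarrow> \<exists>i j. i \<noteq> j \<and> v = edge_vector (i, j)"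
    and odd_meet: "\<And>f n g m. cyclic_seq A f n \<Longrightarrow> odd n \<Longrightarrow> cyclic_seq A g m \<Longrightarrow> odd m \<Longrightarrow>
                     f ` {..<n} \<inter> g ` {..<m} \<noteq> {}"
    and nonneg: "\<And>v. v \<in> S \<Longrightarrow> 0 \<le> c v"
    and ints: "(\<Sum>v\<in>S. c v *\<^sub>R v) \<in> integer_points"
    and total: "(\<Sum>v\<in>S. c v) \<in> \<int>"
  shows "\<exists>c'. (\<forall>v\<in>S. 0 \<le> c' v \<and> c' v \<in> \<int>) \<and> (\<Sum>v\<in>S. c' v *\<^sub>R v) = (\<Sum>v\<in>S. c v *\<^sub>R v) \<and>
           (\<Sum>v\<in>S. w v * c v) \<le> (\<Sum>v\<in>S. w v * c' v)"
  using nonneg ints total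
proof (induction "card {v \<in> S. c v \<notin> \<int>}" arbitrary: c rule: less_induct)
  case less
  let ?F = "{v \<in> S. c v \<notin> \<int>}"
  show ?case
  proof (cases "dependent ?F")
    case True
    obtain c' where c': "\<And>v. v \<in> S \<Longrightarrow> 0 \<le> c' v"
        "(\<Sum>v\<in>S. c' v *\<^sub>R v) = (\<Sum>v\<in>S. c v *\<^sub>R v)"
        "(\<Sum>v\<in>S. w v * c v) \<le> (\<Sum>v\<in>S. w v * c' v)"
        "card {v \<in> S. c' v \<notin> \<int>} < card ?F"
      using shift_along_dependency[OF fin less.prems(1) True, of w] by blast
    have "(\<Sum>v\<in>S. c' v) = (\<Sum>v\<in>S. c v)"
      using sum_coords_weighted_edges[of S c] sum_coords_weighted_edges[of S c'] S c'(2) by simp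
    then have "\<exists>c''. (\<forall>v\<in>S. 0 \<le> c'' v \<and> c'' v \<in> \<int>) \<and>
        (\<Sum>v\<in>S. c'' v *\<^sub>R v) = (\<Sum>v\<in>S. c' v *\<^sub>R v) \<and>
        (\<Sum>v\<in>S. w v * c' v) \<le> (\<Sum>v\<in>S. w v * c'' v)"
      using less.prems(2,3) c'(2) by (intro less.hyps[OF c'(4) c'(1)]) simp_all
    then obtain c'' where c'': "\<forall>v\<in>S. 0 \<le> c'' v \<and> c'' v \<in> \<int>"
        "(\<Sum>v\<in>S. c'' v *\<^sub>R v) = (\<Sum>v\<in>S. c' v *\<^sub>R v)"
        "(\<Sum>v\<in>S. w v * c' v) \<le> (\<Sum>v\<in>S. w v * c'' v)"
      by (elim exE conjE)
    have "(\<Sum>v\<in>S. w v * c v) \<le> (\<Sum>v\<in>S. w v * c'' v)"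
      using c'(3) c''(3) by (rule order_trans)
    then show ?thesis
      using c''(1) c''(2)[unfolded c'(2)] by (intro exI[of _ c''] conjI)
  next
    case False
    \<comment> \<open>Edges of integral weight contribute integers, so integrality of the total and
      of the coordinates passes to the sums over \<open>?F\<close>.\<close>
    have split: "(\<Sum>v\<in>S. h v) = (\<Sum>v\<in>S - ?F. h v) + (\<Sum>v\<in>?F. h v)" for h :: "real ^ 'n \<Rightarrow> real"
      by (rule sum.subset_diff) (use fin in auto)
    have "?F = {}"
    proof (rule independent_fractional_edges_empty[of ?F c])
      show "\<exists>i j. i \<noteq> j \<and> v = edge_vector (i, j)" if "v \<in> ?F" for v
        using S that by simp
      show "independent ?F" by (rule False)
      show "(\<Sum>v\<in>?F. c v) \<in> \<int>"
      proof -
        have "(\<Sum>v\<in>S - ?F. c v) \<in> \<int>" by (rule Ints_sum) auto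
        then have "(\<Sum>v\<in>S. c v) - (\<Sum>v\<in>S - ?F. c v) \<in> \<int>"
          by (rule Ints_diff[OF less.prems(3)])
        then show ?thesis unfolding split[of c] by simp
      qed
      show "(\<Sum>v\<in>?F. c v * v $ i) \<in> \<int>" for i
      proof -
        have "v $ i \<in> \<int>" if "v \<in> S" for v
          using S[OF that] by (auto simp: edge_vector_nth)
        then have "(\<Sum>v\<in>S - ?F. c v * v $ i) \<in> \<int>" by (intro Ints_sum Ints_mult) auto
        moreover have "(\<Sum>v\<in>S. c v * v $ i) \<in> \<int>"
          using less.prems(2) by (simp add: integer_points_def)
        ultimately have "(\<Sum>v\<in>S. c v * v $ i) - (\<Sum>v\<in>S - ?F. c v * v $ i) \<in> \<int>"
          by (intro Ints_diff)
        then show ?thesis unfolding split[of "\<lambda>v. c v * v $ i"] by simp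
      qed
      show "f ` {..<n} \<inter> g ` {..<m} \<noteq> {}"
        if "cyclic_seq {(i, j). i \<noteq> j \<and> edge_vector (i, j) \<in> ?F} f n" "odd n"
          "cyclic_seq {(i, j). i \<noteq> j \<and> edge_vector (i, j) \<in> ?F} g m" "odd m" for f n g m
      proof (rule odd_meet)
        have "{(i, j). i \<noteq> j \<and> edge_vector (i, j) \<in> ?F} \<subseteq> A"
          by (auto simp: A_def)
        then show "cyclic_seq A f n" "cyclic_seq A g m"
          using that cyclic_seq_mono by blast+
      qed (use that in simp_all)
    qed auto
    then have "\<forall>v\<in>S. 0 \<le> c v \<and> c v \<in> \<int>"
      using less.prems(1) by blast
    then show ?thesis by (intro exI[of _ c] conjI refl order_refl)
  qed
qed

section \<open>From integral weights to a decomposition\<close>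

text \<open>The weights serve as multiplicities: \<open>v\<close> is listed \<open>c v\<close>
  times.\<close>

lemma list_of_weights:
  fixes c :: "'a::real_vector \<Rightarrow> real"
  assumes "finite S" "\<And>v. v \<in> S \<Longrightarrow> 0 \<le> c v \<and> c v \<in> \<int>"
  shows "\<exists>xs. set xs \<subseteq> S \<and> real (length xs) = (\<Sum>v\<in>S. c v) \<and> sum_list xs = (\<Sum>v\<in>S. c v *\<^sub>R v)"
  using assms
proof (induction S rule: finite_induct)
  case (insert v S)
  then obtain xs where xs: "set xs \<subseteq> S" "real (length xs) = (\<Sum>v\<in>S. c v)"
      "sum_list xs = (\<Sum>v\<in>S. c v *\<^sub>R v)"
    by auto
  have "c v \<in> \<nat>"
    using insert.prems by (simp add: Nats_altdef2)
  then obtain m where m: "c v = real m" by (auto elim: Nats_cases)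
  have "sum_list (replicate m v) = real m *\<^sub>R v"
    by (induction m) (auto simp: algebra_simps)
  then show ?case
    using insert.hyps xs m by (intro exI[of _ "replicate m v @ xs"]) auto
qed simp

lemma integer_points_add: "x \<in> integer_points \<Longrightarrow> y \<in> integer_points \<Longrightarrow> x + y \<in> integer_points"
  by (simp add: integer_points_def)

lemma edge_vector_integer: "edge_vector e \<in> integer_points"
  by (cases e) (simp add: integer_points_def edge_vector_nth)

lemma edge_polytope_sum_decomposable:
  fixes G1 G2 :: "'n::finite pair_pre_digraph"
  assumes G1: "pair_graph G1"
    and odd_meet: "\<And>p q. odd_cycle G1 p \<Longrightarrow> odd_cycle G1 q \<Longrightarrow> cycle_verts p \<inter> cycle_verts q \<noteq> {}"
    and sub: "parcs G2 \<subseteq> parcs G1"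
    and \<alpha>: "\<alpha> \<in> dilate k (edge_polytope G1 + edge_polytope G2)" "\<alpha> \<in> integer_points"
  shows "integer_decomposable k (edge_polytope G1 + edge_polytope G2) \<alpha>"
proof -
  interpret pair_graph G1 by fact
  define S where "S = edge_vector ` parcs G1"
  define T where "T = edge_vector ` parcs G2"
  have TS: "T \<subseteq> S" and fin: "finite S" "finite T"
    using sub by (auto simp: S_def T_def)
  have P: "edge_polytope G1 = convex hull S" "edge_polytope G2 = convex hull T"
    by (simp_all add: edge_polytope_def S_def T_def)
  obtain a b where a: "\<And>v. v \<in> S \<Longrightarrow> 0 \<le> a v" "(\<Sum>v\<in>S. a v) = 1"
    and b: "\<And>v. v \<in> T \<Longrightarrow> 0 \<le> b v" "(\<Sum>v\<in>T. b v) = 1"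
    and \<alpha>_eq: "\<alpha> = real k *\<^sub>R ((\<Sum>v\<in>S. a v *\<^sub>R v) + (\<Sum>v\<in>T. b v *\<^sub>R v))"
    using \<alpha>(1) unfolding P dilate_def convex_hull_finite[OF fin(1)] convex_hull_finite[OF fin(2)]
    by (auto elim!: set_plus_elim)
  \<comment> \<open>Extending \<open>b\<close> by 0 merges the two convex combinations into one
    weight function \<open>c\<close> on \<open>S\<close>. Its total is \<open>2 * k\<close>, and
    \<open>w\<close> measures the share on \<open>T\<close>, which is at least
    \<open>k\<close>.\<close>
  define b' where "b' v = (if v \<in> T then b v else 0)" for v
  define c where "c v = real k * (a v + b' v)" for v
  define w :: "real ^ 'n \<Rightarrow> real" where "w v = (if v \<in> T then 1 else 0)" for v
  have sum_T: "(\<Sum>v\<in>S. h v) = (\<Sum>v\<in>T. h v)" if "\<And>v. v \<notin> T \<Longrightarrow> h v = 0"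
    for h :: "real ^ 'n \<Rightarrow> 'b::comm_monoid_add"
    using that TS by (intro sum.mono_neutral_right fin) auto
  have b'_sum: "(\<Sum>v\<in>S. b' v) = 1" "(\<Sum>v\<in>S. b' v *\<^sub>R v) = (\<Sum>v\<in>T. b v *\<^sub>R v)"
    using b(2) by (subst sum_T; simp add: b'_def)+
  have c_pos: "0 \<le> c v" if "v \<in> S" for v
    using a(1)[OF that] b(1)[of v] by (auto simp: c_def b'_def)
  have c_vec: "(\<Sum>v\<in>S. c v *\<^sub>R v) = \<alpha>"
  proof -
    have "(\<Sum>v\<in>S. c v *\<^sub>R v) = real k *\<^sub>R ((\<Sum>v\<in>S. a v *\<^sub>R v) + (\<Sum>v\<in>S. b' v *\<^sub>R v))"
      by (simp add: c_def scaleR_add_left scaleR_add_right distrib_left sum.distrib scaleR_sum_right)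
    then show ?thesis by (simp add: \<alpha>_eq b'_sum)
  qed
  have c_total: "(\<Sum>v\<in>S. c v) = 2 * real k"
    unfolding c_def sum_distrib_left[symmetric] sum.distrib a(2) b'_sum(1) by simp
  have c_T: "real k \<le> (\<Sum>v\<in>S. w v * c v)"
  proof -
    have "real k = (\<Sum>v\<in>T. real k * b v)"
      using b(2) by (simp add: sum_distrib_left[symmetric])
    also have "\<dots> \<le> (\<Sum>v\<in>T. c v)"
      using a(1) TS by (intro sum_mono) (auto simp: c_def b'_def intro!: mult_left_mono)
    also have "\<dots> = (\<Sum>v\<in>S. w v * c v)"
      by (subst sum_T) (auto simp: w_def)
    finally show ?thesis .
  qed
  \<comment> \<open>An edge vector determines its edge up to orientation, and the arc set is
    symmetric.\<close>
  have arcs: "{(i, j). i \<noteq> j \<and> edge_vector (i, j) \<in> S} \<subseteq> parcs G1"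
  proof clarify
    fix i j :: 'n assume "i \<noteq> j" "edge_vector (i, j) \<in> S"
    then obtain k l where kl: "(k, l) \<in> parcs G1" "edge_vector (i, j) = edge_vector (k, l)"
      by (auto simp: S_def)
    then have "i = k \<and> j = l \<or> i = l \<and> j = k"
      using edge_vector_eq_iff[OF \<open>i \<noteq> j\<close>] by blast
    moreover have "(l, k) \<in> parcs G1"
      using kl(1) arcs_symmetric by blast
    ultimately show "(i, j) \<in> parcs G1" using kl(1) by blast
  qed
  have odd_meet': "f ` {..<n} \<inter> g ` {..<m} \<noteq> {}"
    if f: "cyclic_seq {(i, j). i \<noteq> j \<and> edge_vector (i, j) \<in> S} f n" "odd n"
      and g: "cyclic_seq {(i, j). i \<noteq> j \<and> edge_vector (i, j) \<in> S} g m" "odd m" for f n g m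
  proof -
    have "cyclic_seq (parcs G1) f n" "cyclic_seq (parcs G1) g m"
      using f(1) g(1) arcs unfolding cyclic_seq_def by blast+
    then obtain p q where "odd_cycle G1 p" "cycle_verts p = f ` {..<n}"
        "odd_cycle G1 q" "cycle_verts q = g ` {..<m}"
      using odd_cycle_of_cyclic_seq[OF G1] f(2) g(2) by metis
    then show ?thesis using odd_meet by metis
  qed
  have S_edges: "\<exists>i j. i \<noteq> j \<and> v = edge_vector (i, j)" if "v \<in> S" for v
    using that no_loops by (fastforce simp: S_def)
  have total: "(\<Sum>v\<in>S. c v) \<in> \<int>"
    by (simp add: c_total)
  have "(\<Sum>v\<in>S. c v *\<^sub>R v) \<in> integer_points"
    using \<alpha>(2) by (simp add: c_vec)
  from integral_edge_weights[OF fin(1) S_edges odd_meet' c_pos this total, of w]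
  obtain c' where c': "\<And>v. v \<in> S \<Longrightarrow> 0 \<le> c' v \<and> c' v \<in> \<int>"
      "(\<Sum>v\<in>S. c' v *\<^sub>R v) = \<alpha>" "(\<Sum>v\<in>S. w v * c v) \<le> (\<Sum>v\<in>S. w v * c' v)"
    unfolding c_vec by blast
  \<comment> \<open>The edges of \<open>T\<close> are listed first, so that the first
    \<open>k\<close> entries of \<open>zs\<close> lie in \<open>T\<close> once
    \<open>k \<le> length xs\<close>.\<close>
  obtain xs where xs: "set xs \<subseteq> T" "real (length xs) = (\<Sum>v\<in>T. c' v)"
      "sum_list xs = (\<Sum>v\<in>T. c' v *\<^sub>R v)"
    using list_of_weights[OF fin(2), of c'] c'(1) TS by blast
  obtain ys where ys: "set ys \<subseteq> S - T" "real (length ys) = (\<Sum>v\<in>S - T. c' v)"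
      "sum_list ys = (\<Sum>v\<in>S - T. c' v *\<^sub>R v)"
    using list_of_weights[of "S - T" c'] fin(1) c'(1) by blast
  define zs where "zs = xs @ ys"
  have zs_sum: "sum_list zs = \<alpha>"
    using sum.subset_diff[OF TS fin(1), of "\<lambda>v. c' v *\<^sub>R v"] xs(3) ys(3) c'(2)
    by (simp add: zs_def add.commute)
  have coord_sum: "(\<Sum>i\<in>UNIV. sum_list us $ i) = 2 * real (length us)" if "set us \<subseteq> S" for us
    using that by (induction us) (auto simp: S_def sum.distrib sum_edge_vector)
  have zs_S: "set zs \<subseteq> S"
    using xs(1) ys(1) TS by (auto simp: zs_def)
  \<comment> \<open>Comparison of two values for the coordinate sum of \<open>\<alpha>\<close>:
    twice the length of \<open>zs\<close>, and twice the total weight \<open>2 * k\<close>.\<close>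
  have len: "length zs = 2 * k"
    using coord_sum[OF zs_S] sum_coords_weighted_edges[OF S_edges, of S c] c_total unfolding zs_sum c_vec by simp
  have "(\<Sum>v\<in>S. w v * c' v) = (\<Sum>v\<in>T. c' v)"
    by (subst sum_T) (auto simp: w_def)
  then have "k \<le> length xs"
    using c'(3) c_T xs(2) by simp
  then have T_nth: "zs ! i \<in> T" if "i < k" for i
    using that xs(1) nth_mem[of i xs] by (auto simp: zs_def nth_append)
  have S_nth: "zs ! i \<in> S" if "i < 2 * k" for i
    using that zs_S len nth_mem[of i zs] by auto
  \<comment> \<open>Each summand joins an edge of \<open>G1\<close> from the second half of
    \<open>zs\<close> to an edge of \<open>G2\<close> from the first half; \<open>i\<close> starts
    at 1, list positions at 0.\<close>
  define d where "d i = zs ! (k + (i - 1)) + zs ! (i - 1)" for i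
  have "d i \<in> (edge_polytope G1 + edge_polytope G2) \<inter> integer_points" if "i \<in> {1..k}" for i
  proof
    have 1: "zs ! (k + (i - 1)) \<in> S" "zs ! (i - 1) \<in> T"
      using that by (auto intro!: S_nth T_nth)
    then show "d i \<in> edge_polytope G1 + edge_polytope G2"
      unfolding P d_def by (intro set_plus_intro hull_inc)
    show "d i \<in> integer_points"
      unfolding d_def using 1 by (auto simp: S_def T_def intro!: integer_points_add edge_vector_integer)
  qed
  moreover have "\<alpha> = (\<Sum>i = 1..k. d i)"
  proof -
    have "(\<Sum>i = 1..k. d i) = (\<Sum>i<k. zs ! (k + i)) + (\<Sum>i<k. zs ! i)"
      unfolding d_def sum.distrib[symmetric]
      by (rule sum.reindex_bij_witness[of _ Suc "\<lambda>i. i - 1"]) auto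
    also have "(\<Sum>i<k. zs ! (k + i)) = (\<Sum>i = k..<k + k. zs ! i)"
      by (rule sum.reindex_bij_witness[of _ "\<lambda>i. i - k" "\<lambda>i. k + i"]) auto
    also have "\<dots> + (\<Sum>i<k. zs ! i) = (\<Sum>i<k + k. zs ! i)"
      by (simp add: lessThan_atLeast0 sum.atLeastLessThan_concat add.commute)
    also have "\<dots> = sum_list zs"
      by (simp add: sum_list_sum_nth len lessThan_atLeast0 mult_2)
    finally show ?thesis by (simp add: zs_sum)
  qed
  ultimately show ?thesis
    unfolding integer_decomposable_def by blast
qed

section \<open>Integrality and normality\<close>

text \<open>The affine lattice is generated by integer points from an integral vertex. Its inclusion
  in the integer points reduces normality to the IDP.\<close>

lemma lattice_polytope:
  assumes "finite V" "V \<subseteq> integer_points"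
  shows "integral_polytope (convex hull V)"
    and "affine_lattice (dilate k (convex hull V)) \<subseteq> integer_points"
proof -
  show "integral_polytope (convex hull V)"
    using assms extreme_point_of_convex_hull unfolding integral_polytope_def polytope_def by blast
  have V: "dilate k (convex hull V) = convex hull ((*\<^sub>R) (real k) ` V)"
    by (simp add: dilate_def convex_hull_scaling)
  show "affine_lattice (dilate k (convex hull V)) \<subseteq> integer_points"
  proof
    fix x assume "x \<in> affine_lattice (dilate k (convex hull V))"
    then obtain v0 z where v0: "v0 extreme_point_of (dilate k (convex hull V))"
      and x: "x = v0 + (\<Sum>v\<in>dilate k (convex hull V) \<inter> integer_points. of_int (z v) *\<^sub>R (v - v0))"
      unfolding affine_lattice_def by blast
    \<comment> \<open>Dilation scales the generators, so a vertex of the dilate is \<open>k\<close>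
      times a point of \<open>V\<close>.\<close>
    have "v0 \<in> (*\<^sub>R) (real k) ` V"
      using v0 extreme_point_of_convex_hull unfolding V by blast
    then have "v0 \<in> integer_points"
      using assms(2) by (auto simp: integer_points_def)
    then show "x \<in> integer_points"
      unfolding x by (auto simp: integer_points_def intro!: Ints_add Ints_sum Ints_mult Ints_diff)
  qed
qed

theorem theorem3p4:
  fixes G1 G2 :: "'n::finite pair_pre_digraph"
  assumes "pair_graph G1"
    and "pverts G1 = UNIV"
    and "Digraph_Component.connected (with_proj G1)"
    and "\<And>p q. odd_cycle G1 p \<Longrightarrow> odd_cycle G1 q \<Longrightarrow> cycle_verts p \<inter> cycle_verts q \<noteq> {}"
    and "pair_graph G2"
    and "subgraph (with_proj G2) (with_proj G1)"
  shows "has_IDP (edge_polytope G1 + edge_polytope G2) \<and>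
         normal_polytope (edge_polytope G1 + edge_polytope G2)"
proof -
  let ?P = "edge_polytope G1 + edge_polytope G2"
  let ?V = "edge_vector ` parcs G1 + edge_vector ` parcs G2"
  have "parcs G2 \<subseteq> parcs G1"
    using assms(6) by (simp add: subgraph_def)
  note decomp = edge_polytope_sum_decomposable[OF assms(1,4) this]
  \<comment> \<open>Convex hulls commute with Minkowski sums, so the sum is itself the hull of
    finitely many integer points.\<close>
  have P: "?P = convex hull ?V"
    by (simp add: edge_polytope_def convex_hull_set_plus)
  have "finite ?V"
    by (intro finite_set_plus) auto
  moreover have "?V \<subseteq> integer_points"
    by (auto elim!: set_plus_elim intro!: integer_points_add edge_vector_integer)
  ultimately have "integral_polytope ?P" "affine_lattice (dilate k ?P) \<subseteq> integer_points" for k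
    unfolding P by (rule lattice_polytope)+
  then show ?thesis
    unfolding has_IDP_def normal_polytope_def using decomp by blast
qed

end
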